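(* Let $\mathcal{G}^{e}$ be an extended summary causal graph (ESCG) with maximal lag $\gamma_{\max}$, let $X$ and $Y$ be distinct time series of $\mathcal{V}$, and let $\gamma \geq 0$. Any set $\mathcal{B}_{\gamma}'$ that satisfies the standard backdoor criterion relative to $(X_{t-\gamma},Y_t)$ on the densest candidate FTCG in $\mathcal{C}(\mathcal{G}^{e})$ is a valid adjustment set for the total effect $P(y_t \mid do(x_{t-\gamma}))$. In addition, the set $$\mathcal{B}_{\gamma} = \{ (Z_{t-\gamma-\ell})_{1\leq \ell \leq \gamma_{\max}} \mid Z_{t^-} \in \mathrm{Par}(X_t, \mathcal{G}^{e})\}\cup \{Z_{t-\gamma} \mid Z_{t} \in \mathrm{Par}(X_t, \mathcal{G}^{e}) \}$$ is a valid adjustment set with respect to the standard backdoor criterion on the densest candidate FTCG.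
   Context: Let $\mathcal{V}$ be a finite set of $p$ observed time series and $\mathcal{V}^f=\{\mathcal{V}_{t-\ell}\mid \ell\in\mathbb{Z}\}$ the set of their temporal instances ($X_{t-\ell}$ is the variable of series $X$ at time $t-\ell$). **Full-time causal graph (FTCG).** The series are generated by an unknown dynamic structural causal model (DSCM; a structural causal model in the sense of Pearl over $\mathcal{V}^f$). Its FTCG $\mathcal{G}^f=(\mathcal{V}^f,\mathcal{E}^f)$ has an edge $X_{t-\gamma}\to Y_t$ iff $X$ directly causes $Y$ at time $t$ with time lag $\gamma$, where $\gamma>0$ if $X=Y$ and $\gamma\ge 0$ if $X\neq Y$. FTCGs are acyclic (instantaneous edges, of lag $0$, are allowed). The DSCM also defines a joint distribution $P$ over $\mathcal{V}^f$, assumed positive, which decomposes recursively along the FTCG as in Bayesian networks. **Standing assumptions.** Causal sufficiency: there is no hidden common cause between any two observed variables. Consistency throughout time: all causal relationships in the FTCG remain constant in direction and magnitude throughout time (so the edge set is invariant under time shift); edges have lag at most a fixed maximal lag $\gamma_{\max}$. **Extended summary causal graph (ESCG).** The ESCG $\mathcal{G}^e=(\mathcal{V}^e,\mathcal{E}^e)$ derived from an FTCG $\mathcal{G}^f$ has two vertices $X_{t^-}$ and $X_t$ for each $X\in\mathcal{V}$; $X_t\to Y_t\in\mathcal{E}^e$ iff $X_t\to Y_t\in\mathcal{E}^f$; and $X_{t^-}\to Y_t\in\mathcal{E}^e$ iff there is at least one lag $0<\ell\le\gamma_{\max}$ with $X_{t-\ell}\to Y_t\in\mathcal{E}^f$.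 **Candidate FTCGs.** $\mathcal{C}(\mathcal{G}^e)$ is the set of all FTCGs (acyclic, satisfying causal sufficiency and consistency throughout time, with maximal lag $\gamma_{\max}$) from which $\mathcal{G}^e$ can be derived. The densest candidate FTCG is the candidate FTCG which contains all potential edges (and is thus maximal in the number of edges). **Total effect and adjustment.** $P(y_t\mid do(x_{t-\gamma}))$ denotes $P(Y_t=y_t\mid do(X_{t-\gamma}=x_{t-\gamma}))$, the distribution of $Y_t$ under Pearl's intervention on the single variable $X_{t-\gamma}$. A set of variables $\mathcal{Z}$ is a valid adjustment set if $P(y_t \mid do(x_{t-\gamma})) = \sum_\mathbf{z} P(y_t\mid x_{t-\gamma}, \mathbf{z}) P(\mathbf{z})$ (validity being required for every candidate FTCG, since the true one is unknown). **Standard backdoor criterion.** In a directed acyclic graph, a backdoor path between $A$ and $B$ is a path between them with an arrowhead into $A$. A path from $A$ to $B$ is active given $\mathcal{Z}$ (with $A,B\notin\mathcal{Z}$) if no non-collider on it is in $\mathcal{Z}$ and every collider on it has a descendant in $\mathcal{Z}$ (each vertex is its own descendant); otherwise $\mathcal{Z}$ blocks it. A set $\mathcal{Z}$ satisfies the standard backdoor criterion relative to $(A,B)$ if no vertex in $\mathcal{Z}$ is a descendant of $A$ and $\mathcal{Z}$ blocks every backdoor path between $A$ and $B$. "Valid adjustment set with respect to the standard backdoor criterion" on a graph means a set satisfying this criterion relative to $(X_{t-\gamma},Y_t)$ in that graph. $\mathrm{Par}(V,\mathcal{G})$ denotes the set of parents of $V$ in $\mathcal{G}$. *)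

theory Defs
  imports "HOL-Probability.Probability"
begin

type_synonym 'v tvar = "'v \<times> int"
type_synonym 'v ftgraph = "('v tvar \<times> 'v tvar) set"

text \<open>
  The observed series are the elements of a finite type, and \<open>(X, t)\<close> is the variable of
  series \<open>X\<close> at time \<open>t\<close>. A full-time graph has all of these as vertices, so only its edges
  are recorded. The third and fourth conjuncts bound the lags and express acyclicity; the last
  one is the invariance of the edges under time shifts.
\<close>

definition is_ftcg :: "nat \<Rightarrow> 'v::finite ftgraph \<Rightarrow> bool" where
  "is_ftcg \<gamma>max E \<longleftrightarrow>
     (\<forall>X s Y t. ((X, s), (Y, t)) \<in> E \<longrightarrow> s \<le> t) \<and>
     (\<forall>X s t. ((X, s), (X, t)) \<in> E \<longrightarrow> s < t) \<and>
     (\<forall>X s Y t. ((X, s), (Y, t)) \<in> E \<longrightarrow> t - s \<le> int \<gamma>max) \<and>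
     acyclic E \<and>
     (\<forall>X s Y t d. ((X, s), (Y, t)) \<in> E \<longleftrightarrow> ((X, s + d), (Y, t + d)) \<in> E)"

datatype 'v evertex = Past 'v | Present 'v

type_synonym 'v egraph = "('v evertex \<times> 'v evertex) set"

definition escg_of :: "nat \<Rightarrow> 'v::finite ftgraph \<Rightarrow> 'v egraph" where
  "escg_of \<gamma>max E =
     {(Present X, Present Y) | X Y t. ((X, t), (Y, t)) \<in> E} \<union>
     {(Past X, Present Y) | X Y t l. 0 < l \<and> l \<le> \<gamma>max \<and> ((X, t - int l), (Y, t)) \<in> E}"

definition is_escg :: "nat \<Rightarrow> 'v::finite egraph \<Rightarrow> bool" where
  "is_escg \<gamma>max Ge \<longleftrightarrow> (\<exists>E. is_ftcg \<gamma>max E \<and> Ge = escg_of \<gamma>max E)"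

definition candidates :: "nat \<Rightarrow> 'v::finite egraph \<Rightarrow> 'v ftgraph set" where
  "candidates \<gamma>max Ge = {E. is_ftcg \<gamma>max E \<and> escg_of \<gamma>max E = Ge}"

definition densest_candidate :: "nat \<Rightarrow> 'v::finite egraph \<Rightarrow> 'v ftgraph" where
  "densest_candidate \<gamma>max Ge =
     (THE E. E \<in> candidates \<gamma>max Ge \<and> (\<forall>E' \<in> candidates \<gamma>max Ge. E' \<subseteq> E))"

definition Par :: "'n \<Rightarrow> ('n \<times> 'n) set \<Rightarrow> 'n set" where
  "Par v E = {u. (u, v) \<in> E}"


subsection \<open>The backdoor criterion\<close>

definition path_between :: "('n \<times> 'n) set \<Rightarrow> 'n \<Rightarrow> 'n \<Rightarrow> 'n list \<Rightarrow> bool" where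
  "path_between E a b p \<longleftrightarrow>
     p \<noteq> [] \<and> hd p = a \<and> last p = b \<and> distinct p \<and>
     (\<forall>i. Suc i < length p \<longrightarrow> (p ! i, p ! Suc i) \<in> E \<or> (p ! Suc i, p ! i) \<in> E)"

definition backdoor_path :: "('n \<times> 'n) set \<Rightarrow> 'n \<Rightarrow> 'n \<Rightarrow> 'n list \<Rightarrow> bool" where
  "backdoor_path E a b p \<longleftrightarrow>
     path_between E a b p \<and> 2 \<le> length p \<and> (p ! 1, p ! 0) \<in> E"

definition collider :: "('n \<times> 'n) set \<Rightarrow> 'n list \<Rightarrow> nat \<Rightarrow> bool" where
  "collider E p i \<longleftrightarrow>
     0 < i \<and> Suc i < length p \<and> (p ! (i - 1), p ! i) \<in> E \<and> (p ! Suc i, p ! i) \<in> E"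

text \<open>
  The endpoints of a path are non-colliders, so a path is active only if neither of its
  endpoints lies in \<open>Z\<close>.
\<close>

definition active :: "('n \<times> 'n) set \<Rightarrow> 'n set \<Rightarrow> 'n list \<Rightarrow> bool" where
  "active E Z p \<longleftrightarrow>
     (\<forall>i < length p. \<not> collider E p i \<longrightarrow> p ! i \<notin> Z) \<and>
     (\<forall>i < length p. collider E p i \<longrightarrow> (\<exists>d \<in> Z. (p ! i, d) \<in> E\<^sup>*))"

definition backdoor_criterion :: "('n \<times> 'n) set \<Rightarrow> 'n \<Rightarrow> 'n \<Rightarrow> 'n set \<Rightarrow> bool" where
  "backdoor_criterion E a b Z \<longleftrightarrow>
     (\<forall>z \<in> Z. (a, z) \<notin> E\<^sup>*) \<and> (\<forall>p. backdoor_path E a b p \<longrightarrow> \<not> active E Z p)"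


subsection \<open>Dynamic structural causal models\<close>

text \<open>
  \<open>causes D Y\<close> is the set of pairs \<open>(X, l)\<close> such that \<open>X\<close> directly causes \<open>Y\<close> with lag \<open>l\<close>,
  and \<open>mech D Y\<close> computes \<open>Y\<close> from the values of these direct causes and the exogenous
  variable of \<open>Y\<close>. Neither the mechanisms nor the laws of the exogenous variables depend on
  time.
\<close>

record ('v, 'a, 'u, 'w) dscm =
  states :: "'v \<Rightarrow> 'a set"
  causes :: "'v \<Rightarrow> ('v \<times> nat) set"
  mech :: "'v \<Rightarrow> ('v \<times> nat \<Rightarrow> 'a) \<Rightarrow> 'u \<Rightarrow> 'a"
  noise_law :: "'v \<Rightarrow> 'u measure"
  sample :: "'w measure"
  noise :: "'v tvar \<Rightarrow> 'w \<Rightarrow> 'u"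
  obs :: "'v tvar \<Rightarrow> 'w \<Rightarrow> 'a"

definition ftcg_of :: "('v, 'a, 'u, 'w) dscm \<Rightarrow> 'v ftgraph" where
  "ftcg_of D = {((X, t - int l), (Y, t)) | X l Y t. (X, l) \<in> causes D Y}"

definition structural_value ::
    "('v, 'a, 'u, 'w) dscm \<Rightarrow> ('v tvar \<Rightarrow> 'w \<Rightarrow> 'a) \<Rightarrow> 'v tvar \<Rightarrow> 'w \<Rightarrow> 'a" where
  "structural_value D V v \<omega> =
     mech D (fst v) (\<lambda>c \<in> causes D (fst v). V (fst c, snd v - int (snd c)) \<omega>) (noise D v \<omega>)"

text \<open>
  Causal sufficiency is the joint independence of the exogenous variables. Since time has no
  beginning, the structural equations alone do not determine the observed process: as in
  an acyclic model with finitely many variables, each observed variable is required to be a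
  function of the exogenous variables of its ancestors. Without this, series without common
  ancestors could be dependent through the infinite past. The recursive factorization of the
  joint distribution is a consequence.
\<close>

definition is_dscm :: "('v, 'a, 'u, 'w) dscm \<Rightarrow> bool" where
  "is_dscm D \<longleftrightarrow>
     prob_space (sample D) \<and>
     (\<forall>X. countable (states D X)) \<and>
     (\<forall>X. \<forall>h \<in> (\<Pi>\<^sub>E c \<in> causes D X. states D (fst c)).
        mech D X h \<in> noise_law D X \<rightarrow>\<^sub>M count_space (states D X)) \<and>
     prob_space.indep_vars (sample D) (\<lambda>v. noise_law D (fst v)) (noise D) UNIV \<and>
     (\<forall>X t. distr (sample D) (noise_law D X) (noise D (X, t)) = noise_law D X) \<and>
     (\<forall>v. \<forall>\<omega> \<in> space (sample D). obs D v \<omega> = structural_value D (obs D) v \<omega>) \<and>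
     (\<forall>v. \<exists>g \<in> (\<Pi>\<^sub>M w \<in> {w. (w, v) \<in> (ftcg_of D)\<^sup>*}. noise_law D (fst w))
                 \<rightarrow>\<^sub>M count_space (states D (fst v)).
        \<forall>\<omega> \<in> space (sample D).
          obs D v \<omega> = g (\<lambda>w \<in> {w. (w, v) \<in> (ftcg_of D)\<^sup>*}. noise D w \<omega>))"

definition positive_dscm :: "('v, 'a, 'u, 'w) dscm \<Rightarrow> bool" where
  "positive_dscm D \<longleftrightarrow>
     (\<forall>F. finite F \<longrightarrow> (\<forall>a \<in> (\<Pi>\<^sub>E v \<in> F. states D (fst v)).
        \<P>(\<omega> in sample D. \<forall>v \<in> F. obs D v \<omega> = a v) > 0))"

text \<open>
  The solution of the model in which the structural equation of the variable \<open>a\<close> is replaced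
  by the constant \<open>x\<close>. It is computed from the same exogenous variables, and it agrees with the
  original process before the time of \<open>a\<close>; for an acyclic model this determines it uniquely.
\<close>

definition do_obs ::
    "('v, 'a, 'u, 'w) dscm \<Rightarrow> 'v tvar \<Rightarrow> 'a \<Rightarrow> 'v tvar \<Rightarrow> 'w \<Rightarrow> 'a" where
  "do_obs D a x = (THE V.
     (\<forall>v. snd v < snd a \<longrightarrow> V v = obs D v) \<and>
     V a = (\<lambda>_. x) \<and>
     (\<forall>v. snd a \<le> snd v \<and> v \<noteq> a \<longrightarrow> V v = structural_value D V v))"

definition adjusts ::
    "('v, 'a, 'u, 'w) dscm \<Rightarrow> 'v tvar \<Rightarrow> 'v tvar \<Rightarrow> 'v tvar set \<Rightarrow> bool" where
  "adjusts D a b Z \<longleftrightarrow>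
     (\<forall>x \<in> states D (fst a). \<forall>y \<in> states D (fst b).
        \<P>(\<omega> in sample D. do_obs D a x b \<omega> = y) =
        (\<Sum>\<^sub>\<infinity>z \<in> (\<Pi>\<^sub>E v \<in> Z. states D (fst v)).
           \<P>(\<omega> in sample D. obs D b \<omega> = y \<bar> obs D a \<omega> = x \<and> (\<forall>v \<in> Z. obs D v \<omega> = z v)) *
           \<P>(\<omega> in sample D. \<forall>v \<in> Z. obs D v \<omega> = z v)))"

text \<open>
  The first argument only fixes the types of the state, exogenous and sample spaces over which
  the models range.
\<close>

definition valid_adjustment ::
    "('v::finite, 'a, 'u, 'w) dscm itself \<Rightarrow> nat \<Rightarrow> 'v egraph \<Rightarrow>
     'v tvar \<Rightarrow> 'v tvar \<Rightarrow> 'v tvar set \<Rightarrow> bool" where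
  "valid_adjustment _ \<gamma>max Ge a b Z \<longleftrightarrow>
     (\<forall>E \<in> candidates \<gamma>max Ge. \<forall>D :: ('v, 'a, 'u, 'w) dscm.
        is_dscm D \<and> positive_dscm D \<and> ftcg_of D = E \<longrightarrow> adjusts D a b Z)"

definition B_set :: "nat \<Rightarrow> 'v::finite egraph \<Rightarrow> 'v \<Rightarrow> int \<Rightarrow> nat \<Rightarrow> 'v tvar set" where
  "B_set \<gamma>max Ge X t \<gamma> =
     {(Z, t - int \<gamma> - int l) | Z l. 1 \<le> l \<and> l \<le> \<gamma>max \<and> Past Z \<in> Par (Present X) Ge} \<union>
     {(Z, t - int \<gamma>) | Z. Present Z \<in> Par (Present X) Ge}"

end

theory Submission imports Defs begin

text \<open>
The densest candidate unfolds every edge of the summary graph to all admissible lags, so it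
contains every candidate. The backdoor criterion is inherited by subgraphs of an acyclic graph
(\<open>backdoor_criterion_mono\<close>): a subgraph has fewer descendants and fewer active paths. Hence the
given set satisfies the criterion in the graph of the true model, whichever candidate that is.
The set \<open>B_set\<close> consists of the parents of \<open>X\<close> at the time of the intervention in the densest
candidate, and the parents of a vertex satisfy the criterion in every acyclic graph.

It remains to prove that backdoor adjustment is sound in one model with infinite past
(\<open>backdoor_adjusts\<close>). Write \<open>a\<close> for the treatment, \<open>b\<close> for the outcome and \<open>Z\<close> for the adjustment
set. If \<open>b\<close> is in \<open>Z\<close>, it is no descendant of \<open>a\<close> and the formula is immediate. Otherwise, fix values
of \<open>a\<close> and of \<open>Z\<close>. In the pinned process all equations read these fixed values instead of the
variables in \<open>insert a Z\<close>, which otherwise keep their own equations. Each pinned variable is a function of the exogenous variables of those of its ancestors that reach it without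
using an edge out of \<open>insert a Z\<close>. On the event that \<open>Z\<close> takes the fixed value, the pinned process
agrees with the observed one at \<open>Z\<close> and at \<open>a\<close>, because \<open>Z\<close> contains no descendant of \<open>a\<close>, and with
the process under the intervention at \<open>b\<close>. So the adjustment formula reduces to the conditional
independence of the pinned \<open>a\<close> and \<open>b\<close> given the pinned \<open>Z\<close>.

For this, link two of these finitely many variables if they share an exogenous variable. If
\<open>b\<close> is not connected to \<open>a\<close> by a chain of links through \<open>Z\<close>, the variables fall into two independent
groups, one with \<open>a\<close> and one with \<open>b\<close>, which gives the conditional independence
(\<open>pinned_cond_indep\<close>). Otherwise, going up to the common ancestor and down again for each link
traces out a walk from \<open>a\<close> to \<open>b\<close> that starts with an edge into \<open>a\<close>, has colliders only in \<open>Z\<close> and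
non-colliders only outside \<open>Z\<close>. Cutting out its closed subwalks turns it into an active backdoor path
(\<open>backdoor_criterion_not_linked\<close>), which contradicts the criterion. In contrast to an argument
by factorization of a joint density, this one needs no bound on the number of ancestors.
\<close>

section \<open>Open walks and active paths\<close>

text \<open>
Walks may repeat vertices, so they can be concatenated freely; a vertex of a walk is judged by
its two neighbours on the walk, by the same rule as on an active path. Only interior vertices are
judged, which lets a walk end in \<open>Z\<close> and be continued from there.
\<close>
definition open_at :: "('n \<times> 'n) set \<Rightarrow> 'n set \<Rightarrow> 'n \<Rightarrow> 'n \<Rightarrow> 'n \<Rightarrow> bool" where
  "open_at H Z u v w \<longleftrightarrow>
     (if (u, v) \<in> H \<and> (w, v) \<in> H then \<exists>d \<in> Z. (v, d) \<in> H\<^sup>* else v \<notin> Z)"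

fun open_walk :: "('n \<times> 'n) set \<Rightarrow> 'n set \<Rightarrow> 'n list \<Rightarrow> bool" where
  "open_walk H Z (u # v # r) \<longleftrightarrow>
     ((u, v) \<in> H \<or> (v, u) \<in> H) \<and>
     (case r of [] \<Rightarrow> True | w # _ \<Rightarrow> open_at H Z u v w) \<and> open_walk H Z (v # r)"
| "open_walk H Z _ \<longleftrightarrow> True"

lemma open_walk_append:
  "open_walk H Z (xs @ v # ys) \<longleftrightarrow>
     open_walk H Z (xs @ [v]) \<and> open_walk H Z (v # ys) \<and>
     (xs \<noteq> [] \<and> ys \<noteq> [] \<longrightarrow> open_at H Z (last xs) v (hd ys))"
proof (induction xs)
  case Nil
  then show ?case by simp
next
  case (Cons x xs)
  show ?case
  proof (cases xs)
    case Nil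
    then show ?thesis by (cases ys) auto
  next
    case (Cons y zs)
    then show ?thesis using Cons.IH by (cases zs) auto
  qed
qed

text \<open>
A walk that leaves \<open>c\<close> along an edge out of \<open>c\<close> and at its other end meets an edge out of \<open>d\<close> has
to change direction in between. The first change of direction is a collider and a descendant
of \<open>c\<close>, and the descendant in \<open>Z\<close> of this collider is one of \<open>c\<close>.
\<close>
lemma open_walk_turn:
  assumes "open_walk H Z (c # ys @ [d])" "ys \<noteq> []" "(c, hd ys) \<in> H" "(d, last ys) \<in> H"
  shows "\<exists>e \<in> Z. (c, e) \<in> H\<^sup>*"
  using assms
proof (induction ys arbitrary: c)
  case Nil
  then show ?case by simp
next
  case (Cons y ys)
  have cy: "(c, y) \<in> H" using Cons.prems by simp
  define w where "w = hd (ys @ [d])"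
  have at: "open_at H Z c y w" and y: "open_walk H Z (y # ys @ [d])"
    using Cons.prems(1) unfolding w_def by (cases ys; simp)+
  have "\<exists>e \<in> Z. (y, e) \<in> H\<^sup>*"
  proof (cases "(w, y) \<in> H")
    case True
    then show ?thesis using at cy by (simp add: open_at_def)
  next
    case False
    then have ne: "ys \<noteq> []" using Cons.prems(4) unfolding w_def by (cases ys) auto
    then have "(y, hd ys) \<in> H" using y False unfolding w_def by (cases ys) auto
    then show ?thesis using Cons.IH[OF y ne] Cons.prems(4) ne by simp
  qed
  then show ?case using cy by (meson converse_rtrancl_into_rtrancl)
qed

text \<open>
Cutting out a closed subwalk changes the neighbours of \<open>c\<close> only. If \<open>c\<close> is a non-collider
afterwards, it was one at its first or at its second occurrence. If it is a collider afterwards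
but was not at either occurrence, then the closed subwalk leaves \<open>c\<close> along an edge out of \<open>c\<close> and
also returns against such an edge, so \<open>open_walk_turn\<close> applies.
\<close>
lemma open_walk_cut:
  assumes "acyclic H" "open_walk H Z (xs @ c # ys @ c # zs)"
  shows "open_walk H Z (xs @ c # zs)"
proof -
  have xs: "open_walk H Z (xs @ [c])" and cyc: "open_walk H Z (c # ys @ c # zs)"
    and left: "xs \<noteq> [] \<Longrightarrow> open_at H Z (last xs) c (hd (ys @ [c]))"
    using assms(2) open_walk_append[of H Z xs c "ys @ c # zs"] by (cases ys; auto)+
  have loop: "open_walk H Z (c # ys @ [c])" and zs: "open_walk H Z (c # zs)"
    and right: "zs \<noteq> [] \<Longrightarrow> open_at H Z (last (c # ys)) c (hd zs)"
    using cyc open_walk_append[of H Z "c # ys" c zs] by auto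
  have irr: "(c, c) \<notin> H" using assms(1) by (auto simp: acyclic_def)
  have asym: "(v, u) \<notin> H" if "(u, v) \<in> H" for u v
    using assms(1) that by (meson acyclic_def r_into_trancl trancl_into_trancl)
  have ne: "ys \<noteq> []" using loop irr by (cases ys) auto
  have adj: "(c, hd ys) \<in> H \<or> (hd ys, c) \<in> H"
    using loop ne by (cases ys) auto
  have adj': "(c, last ys) \<in> H \<or> (last ys, c) \<in> H"
  proof -
    have "ys = butlast ys @ [last ys]" using ne by simp
    then have "open_walk H Z ((c # butlast ys) @ last ys # [c])" using loop
      by (metis append.assoc append_Cons append_Nil)
    then have "open_walk H Z (last ys # [c])"
      using open_walk_append[of H Z "c # butlast ys" "last ys" "[c]"] by blast
    then show ?thesis by auto
  qed
  \<comment> \<open>If \<open>xs\<close> or \<open>zs\<close> is empty, \<open>c\<close> is an endpoint of the shortened walk and is not judged.\<close>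
  have "open_at H Z (last xs) c (hd zs)" if "xs \<noteq> []" "zs \<noteq> []"
  proof (cases "(last xs, c) \<in> H \<and> (hd zs, c) \<in> H")
    case False
    then show ?thesis using left right that ne by (auto simp: open_at_def split: if_splits)
  next
    case True
    have "\<exists>d \<in> Z. (c, d) \<in> H\<^sup>*"
    proof (cases "(hd ys, c) \<in> H \<or> (last ys, c) \<in> H")
      case True
      then show ?thesis using left right that ne \<open>(last xs, c) \<in> H \<and> (hd zs, c) \<in> H\<close>
        by (auto simp: open_at_def)
    next
      case False
      then show ?thesis using open_walk_turn[OF loop ne] adj adj' by blast
    qed
    with True show ?thesis by (simp add: open_at_def)
  qed
  then show ?thesis using xs zs by (subst open_walk_append) blast
qed

lemma open_walk_distinct:
  assumes "acyclic H" "open_walk H Z p" "p \<noteq> []"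
  shows "\<exists>q. open_walk H Z q \<and> q \<noteq> [] \<and> hd q = hd p \<and> last q = last p \<and> distinct q"
  using assms(2,3)
proof (induction p rule: length_induct)
  case (1 p)
  show ?case
  proof (cases "distinct p")
    case True
    with 1 show ?thesis by blast
  next
    case False
    then obtain xs c ys zs where p: "p = xs @ c # ys @ c # zs"
      using not_distinct_decomp by fastforce
    have "open_walk H Z (xs @ c # zs)" using open_walk_cut[OF assms(1)] 1 p by blast
    moreover have "hd (xs @ c # zs) = hd p" "last (xs @ c # zs) = last p"
      using p by (cases xs; simp)+
    moreover have "length (xs @ c # zs) < length p" using p by simp
    ultimately show ?thesis using 1(1) by (metis Nil_is_append_conv list.distinct(1))
  qed
qed

lemma open_walk_edge:
  assumes "open_walk H Z p" "Suc i < length p"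
  shows "(p ! i, p ! Suc i) \<in> H \<or> (p ! Suc i, p ! i) \<in> H"
proof -
  have "p = take i p @ p ! i # p ! Suc i # drop (Suc (Suc i)) p"
    using assms(2) by (metis Cons_nth_drop_Suc Suc_lessD append_take_drop_id)
  then have "open_walk H Z (p ! i # p ! Suc i # drop (Suc (Suc i)) p)"
    using assms(1) open_walk_append by metis
  then show ?thesis by simp
qed

lemma open_walk_interior:
  assumes "open_walk H Z p" "0 < i" "Suc i < length p"
  shows "open_at H Z (p ! (i - 1)) (p ! i) (p ! Suc i)"
proof -
  obtain j where i: "i = Suc j" using assms(2) by (cases i) auto
  have "p = take j p @ p ! j # p ! i # p ! Suc i # drop (Suc (Suc i)) p"
    using assms(3) unfolding i by (metis Cons_nth_drop_Suc Suc_lessD append_take_drop_id)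
  then have "open_walk H Z (p ! j # p ! i # p ! Suc i # drop (Suc (Suc i)) p)"
    using assms(1) open_walk_append by metis
  then show ?thesis by (simp add: i)
qed

text \<open>
This reduces the search for an active path to that for an open walk between the same endpoints.
\<close>
lemma open_walk_active_path:
  assumes "acyclic H" "open_walk H Z p" "p \<noteq> []" "hd p \<notin> Z" "last p \<notin> Z"
  shows "\<exists>q. path_between H (hd p) (last p) q \<and> active H Z q"
proof -
  obtain q where q: "open_walk H Z q" "q \<noteq> []" "hd q = hd p" "last q = last p" "distinct q"
    using open_walk_distinct[OF assms(1-3)] by blast
  have "path_between H (hd p) (last p) q"
    using q open_walk_edge[OF q(1)] unfolding path_between_def by simp
  moreover have "active H Z q"
    unfolding active_def
  proof (intro conjI allI impI)
    fix i assume i: "i < length q" "\<not> collider H q i"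
    consider "i = 0" | "Suc i = length q" | "0 < i" "Suc i < length q" using i(1) by linarith
    then show "q ! i \<notin> Z"
    proof cases
      case 1
      then show ?thesis using q assms(4) by (simp add: hd_conv_nth)
    next
      case 2
      then have "q ! i = last q" using q(2) by (metis diff_Suc_1 last_conv_nth)
      then show ?thesis using q assms(5) by simp
    next
      case 3
      then show ?thesis using open_walk_interior[OF q(1) 3] i(2)
        by (auto simp: open_at_def collider_def)
    qed
  next
    fix i assume i: "i < length q" "collider H q i"
    then have "0 < i" "Suc i < length q" by (auto simp: collider_def)
    then show "\<exists>d \<in> Z. (q ! i, d) \<in> H\<^sup>*"
      using open_walk_interior[OF q(1)] i(2) by (auto simp: open_at_def collider_def)
  qed
  ultimately show ?thesis by blast
qed

section \<open>The backdoor criterion in subgraphs and for parents\<close>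

text \<open>
An acyclic supergraph cannot orient the edges of the path in the other direction as well, so the
colliders stay the same, and their descendants can only increase in number.
\<close>
lemma active_mono:
  assumes "G \<subseteq> H" "acyclic H" "path_between G a b p" "active G Z p"
  shows "path_between H a b p" "active H Z p"
proof -
  show "path_between H a b p" using assms(1,3) unfolding path_between_def by blast
  have asym: "(v, u) \<notin> H" if "(u, v) \<in> H" for u v
    using assms(2) that by (meson acyclic_def r_into_trancl trancl_into_trancl)
  have edge: "(p ! i, p ! Suc i) \<in> G \<or> (p ! Suc i, p ! i) \<in> G" if "Suc i < length p" for i
    using assms(3) that by (auto simp: path_between_def)
  have orient: "(u, v) \<in> H \<longleftrightarrow> (u, v) \<in> G" if "(u, v) \<in> G \<or> (v, u) \<in> G" for u v
    using that assms(1) asym by blast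
  have "collider H p i \<longleftrightarrow> collider G p i" for i
  proof (cases i)
    case (Suc j)
    show ?thesis
    proof (cases "Suc i < length p")
      case True
      then show ?thesis
        using orient[OF edge[of j]] orient[of "p ! Suc i" "p ! i"] edge[of i] Suc
        unfolding collider_def by auto
    qed (simp add: collider_def)
  qed (simp add: collider_def)
  moreover have "G\<^sup>* \<subseteq> H\<^sup>*" using assms(1) by (rule rtrancl_mono)
  ultimately show "active H Z p" using assms(4) unfolding active_def by blast
qed

lemma backdoor_criterion_mono:
  assumes "G \<subseteq> H" "acyclic H" "backdoor_criterion H a b Z"
  shows "backdoor_criterion G a b Z"
proof -
  have "G\<^sup>* \<subseteq> H\<^sup>*" using assms(1) by (rule rtrancl_mono)
  then show ?thesis
    using assms active_mono[OF assms(1,2)]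
    unfolding backdoor_criterion_def backdoor_path_def by blast
qed

text \<open>
A backdoor path enters \<open>a\<close> from a parent, which is a non-collider on the path because acyclicity
forbids the reverse edge. The parent may be \<open>b\<close> itself; the path is then blocked since
endpoints in the adjustment set block.
\<close>
lemma parents_backdoor_criterion:
  assumes "acyclic E"
  shows "backdoor_criterion E a b (Par a E)"
  unfolding backdoor_criterion_def
proof (intro conjI ballI allI impI)
  fix z assume "z \<in> Par a E"
  then show "(a, z) \<notin> E\<^sup>*"
    using assms by (auto simp: Par_def acyclic_def dest: rtrancl_into_trancl1)
next
  fix p assume p: "backdoor_path E a b p"
  then have len: "1 < length p" and e: "(p ! 1, p ! 0) \<in> E" and "p ! 0 = a"
    by (auto simp: backdoor_path_def path_between_def hd_conv_nth)
  have "(p ! 0, p ! 1) \<notin> E"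
    using assms e by (meson acyclic_def r_into_trancl trancl_into_trancl)
  then have "\<not> collider E p 1" by (simp add: collider_def)
  moreover have "p ! 1 \<in> Par a E" using e \<open>p ! 0 = a\<close> by (simp add: Par_def)
  ultimately show "\<not> active E (Par a E) p" using len unfolding active_def by blast
qed

section \<open>Vertices that share an ancestor after a cut\<close>

definition cut_out :: "'n set \<Rightarrow> ('n \<times> 'n) set \<Rightarrow> ('n \<times> 'n) set" where
  "cut_out S E = {(u, v) \<in> E. u \<notin> S}"

text \<open>
In a model with independent exogenous variables, two variables that are not linked are functions
of disjoint sets of exogenous variables.
\<close>
definition linked :: "('n \<times> 'n) set \<Rightarrow> 'n \<Rightarrow> 'n \<Rightarrow> bool" where
  "linked G v w \<longleftrightarrow> (\<exists>c. (c, v) \<in> G\<^sup>* \<and> (c, w) \<in> G\<^sup>*)"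

text \<open>
The vertices that can be reached from \<open>a\<close> by a chain of links with all later members in \<open>Z\<close>. No
vertex of the component is linked to a vertex of \<open>Z\<close> outside it.
\<close>
inductive_set component :: "('n \<times> 'n) set \<Rightarrow> 'n set \<Rightarrow> 'n \<Rightarrow> 'n set" for G Z a where
  start: "a \<in> component G Z a"
| step: "v \<in> component G Z a \<Longrightarrow> w \<in> Z \<Longrightarrow> linked G v w \<Longrightarrow> w \<in> component G Z a"

lemma component_subset: "component G Z a \<subseteq> insert a Z"
proof
  fix v assume "v \<in> component G Z a"
  then show "v \<in> insert a Z" by cases auto
qed

text \<open>
The invariant under which a walk \<open>xs @ [v]\<close> can be continued by an edge into \<open>v\<close>: the last edge
points into \<open>v\<close> if \<open>v\<close> is in \<open>Z\<close>, which makes \<open>v\<close> an open collider, and out of \<open>v\<close> otherwise, which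
makes \<open>v\<close> an open non-collider. With \<open>xs = []\<close> the vertex \<open>v\<close> stays an endpoint and is not judged.
\<close>
definition extendable :: "('n \<times> 'n) set \<Rightarrow> 'n set \<Rightarrow> 'n list \<Rightarrow> 'n \<Rightarrow> bool" where
  "extendable H Z xs v \<longleftrightarrow>
     xs = [] \<or> v \<in> Z \<and> (last xs, v) \<in> H \<or> v \<notin> Z \<and> (v, last xs) \<in> H"

text \<open>
Every vertex above \<open>v\<close> on a directed path of the cut graph has an edge out of it there, so it is
not in \<open>Z\<close>, and it is passed against the direction of the edges as a non-collider.
\<close>
lemma open_walk_upwards:
  assumes "acyclic H" "(c, v) \<in> (cut_out Z H)\<^sup>*"
    and "open_walk H Z (xs @ [v])" "hd (xs @ [v]) = a" "extendable H Z xs v"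
  shows "\<exists>ys. open_walk H Z (ys @ [c]) \<and> hd (ys @ [c]) = a \<and> extendable H Z ys c"
  using assms(2)
proof (induction rule: converse_rtrancl_induct)
  case base
  then show ?case using assms by blast
next
  case (step u w)
  obtain ys where ys: "open_walk H Z (ys @ [w])" "hd (ys @ [w]) = a" "extendable H Z ys w"
    using step.IH by blast
  have e: "(u, w) \<in> H" "u \<notin> Z" using step.hyps(1) by (auto simp: cut_out_def)
  have "open_at H Z (last ys) w u" if "ys \<noteq> []"
  proof -
    have asym: "(w, last ys) \<in> H \<Longrightarrow> (last ys, w) \<notin> H"
      using assms(1) by (meson acyclic_def r_into_trancl trancl_into_trancl)
    show ?thesis using ys(3) that e asym unfolding extendable_def open_at_def by auto
  qed
  then have "open_walk H Z (ys @ w # [u])"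
    using ys(1) e by (subst open_walk_append) auto
  moreover have "hd ((ys @ [w]) @ [u]) = a" using ys(2) by (cases ys) auto
  moreover have "extendable H Z (ys @ [w]) u" using e by (simp add: extendable_def)
  ultimately show ?case by (intro exI[of _ "ys @ [w]"]) simp
qed

text \<open>
The walk goes on along an edge out of each vertex that it passes. Such a vertex is therefore outside
\<open>Z\<close>, and it is a non-collider no matter how the walk arrived at it, so the start need not be
\<open>extendable\<close>.
\<close>
lemma open_walk_downwards:
  assumes "acyclic H" "(c, w) \<in> (cut_out Z H)\<^sup>*"
    and "open_walk H Z (xs @ [c])" "hd (xs @ [c]) = a"
  shows "\<exists>ys. open_walk H Z (ys @ [w]) \<and> hd (ys @ [w]) = a \<and>
           (w = c \<or> ys \<noteq> [] \<and> (last ys, w) \<in> H)"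
  using assms(2)
proof (induction rule: rtrancl_induct)
  case base
  then show ?case using assms by blast
next
  case (step u w)
  obtain ys where ys: "open_walk H Z (ys @ [u])" "hd (ys @ [u]) = a"
    using step.IH by blast
  have e: "(u, w) \<in> H" "u \<notin> Z" using step.hyps(2) by (auto simp: cut_out_def)
  have "(w, u) \<notin> H"
    using assms(1) e by (meson acyclic_def r_into_trancl trancl_into_trancl)
  then have "open_at H Z (last ys) u w" using e by (simp add: open_at_def)
  then have "open_walk H Z (ys @ u # [w])"
    using ys(1) e by (subst open_walk_append) auto
  moreover have "hd ((ys @ [u]) @ [w]) = a" using ys(2) by (cases ys) auto
  ultimately show ?case using e by (intro exI[of _ "ys @ [u]"]) simp
qed

text \<open>
A link from \<open>v\<close> to \<open>w\<close> through a common ancestor \<open>c\<close> extends a walk from \<open>v\<close> up to \<open>c\<close> and down to \<open>w\<close>.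
Unless the walk stays the same because \<open>w\<close> is \<open>v\<close>, the new end \<open>w\<close> in \<open>Z\<close> is entered by an edge
into it, so the next link can be attached there.
\<close>
lemma open_walk_component:
  assumes "acyclic H" "v \<in> component (cut_out Z H) Z a"
  shows "\<exists>xs. open_walk H Z (xs @ [v]) \<and> hd (xs @ [v]) = a \<and> extendable H Z xs v"
  using assms(2)
proof induction
  case start
  show ?case by (rule exI[of _ "[]"]) (simp add: extendable_def)
next
  case (step v w)
  obtain c where c: "(c, v) \<in> (cut_out Z H)\<^sup>*" "(c, w) \<in> (cut_out Z H)\<^sup>*"
    using step.hyps(3) unfolding linked_def by blast
  obtain xs where xs: "open_walk H Z (xs @ [c])" "hd (xs @ [c]) = a" "extendable H Z xs c"
    using open_walk_upwards[OF assms(1) c(1)] step.IH by blast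
  obtain ys where ys: "open_walk H Z (ys @ [w])" "hd (ys @ [w]) = a"
      "w = c \<or> ys \<noteq> [] \<and> (last ys, w) \<in> H"
    using open_walk_downwards[OF assms(1) c(2) xs(1,2)] by blast
  show ?case
  proof (cases "w = c")
    case True
    then show ?thesis using xs by blast
  next
    case False
    then show ?thesis using ys step.hyps(2) unfolding extendable_def by blast
  qed
qed

text \<open>
The graphical core of the adjustment theorem. Links are taken in the graph without edges out of
\<open>a\<close> and out of \<open>Z\<close>. A link of \<open>b\<close> to the component of \<open>a\<close> yields an open walk, and hence an active
path, from \<open>a\<close> to \<open>b\<close> in the graph without edges out of \<open>a\<close>. Such a path can only leave \<open>a\<close> against
an edge, so it is a backdoor path.
\<close>
lemma backdoor_criterion_not_linked:
  assumes "acyclic E" "backdoor_criterion E a b Z" "a \<noteq> b" "b \<notin> Z"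
    and v: "v \<in> component (cut_out (insert a Z) E) Z a"
  shows "\<not> linked (cut_out (insert a Z) E) v b"
proof
  \<comment> \<open>Removing the edges out of \<open>a\<close> makes every path that starts at \<open>a\<close> a backdoor path; removing
    those out of \<open>Z\<close> as well leaves only directed paths with all vertices but the last outside \<open>Z\<close>.\<close>
  define H where "H = cut_out {a} E"
  have G: "cut_out (insert a Z) E = cut_out Z H" by (auto simp: H_def cut_out_def)
  have HE: "H \<subseteq> E" by (auto simp: H_def cut_out_def)
  then have acyc: "acyclic H" using assms(1) acyclic_subset by blast
  assume "linked (cut_out (insert a Z) E) v b"
  then obtain c where c: "(c, v) \<in> (cut_out Z H)\<^sup>*" "(c, b) \<in> (cut_out Z H)\<^sup>*"
    unfolding linked_def G by blast
  obtain xs where "open_walk H Z (xs @ [v])" "hd (xs @ [v]) = a" "extendable H Z xs v"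
    using open_walk_component[OF acyc v[unfolded G]] by blast
  then obtain ys where "open_walk H Z (ys @ [c])" "hd (ys @ [c]) = a"
    using open_walk_upwards[OF acyc c(1)] by blast
  then obtain p where p: "open_walk H Z (p @ [b])" "hd (p @ [b]) = a"
    using open_walk_downwards[OF acyc c(2)] by blast
  have "a \<notin> Z" using assms(2) unfolding backdoor_criterion_def by blast
  then obtain q where q: "path_between H a b q" "active H Z q"
    using open_walk_active_path[OF acyc p(1)] p(2) assms(4) by auto
  have len: "2 \<le> length q"
    using q(1) \<open>a \<noteq> b\<close> unfolding path_between_def by (cases q; cases "tl q") auto
  have "(q ! 0, q ! 1) \<in> H \<or> (q ! 1, q ! 0) \<in> H"
    using q(1) len unfolding path_between_def by (metis One_nat_def Suc_1 Suc_le_lessD)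
  moreover have "q ! 0 = a" using q(1) by (auto simp: path_between_def hd_conv_nth)
  ultimately have "(q ! 1, q ! 0) \<in> E" using HE by (auto simp: H_def cut_out_def)
  then have "backdoor_path E a b q" "active E Z q"
    using active_mono[OF HE assms(1) q] len by (auto simp: backdoor_path_def)
  then show False using assms(2) unfolding backdoor_criterion_def by blast
qed

section \<open>The densest candidate\<close>

text \<open>
The densest candidate in explicit form: every edge of the summary graph is unfolded to all lags
that it allows.
\<close>
definition full_lag_graph :: "nat \<Rightarrow> 'v::finite egraph \<Rightarrow> 'v ftgraph" where
  "full_lag_graph \<gamma>max Ge =
     {((X, t), (Y, t)) | X Y t. (Present X, Present Y) \<in> Ge} \<union>
     {((X, t - int l), (Y, t)) | X Y t l. 0 < l \<and> l \<le> \<gamma>max \<and> (Past X, Present Y) \<in> Ge}"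

lemma candidate_subset_full_lag_graph:
  assumes "E \<in> candidates \<gamma>max Ge"
  shows "E \<subseteq> full_lag_graph \<gamma>max Ge"
proof
  fix e assume e: "e \<in> E"
  obtain X s Y t where e': "e = ((X, s), (Y, t))" by (metis surj_pair)
  have E: "is_ftcg \<gamma>max E" and Ge: "escg_of \<gamma>max E = Ge"
    using assms by (auto simp: candidates_def)
  have "s \<le> t" "t - s \<le> int \<gamma>max" using E e unfolding e' is_ftcg_def by blast+
  show "e \<in> full_lag_graph \<gamma>max Ge"
  proof (cases "s = t")
    case True
    then have "(Present X, Present Y) \<in> Ge"
      using e e' Ge by (auto simp: escg_of_def)
    then show ?thesis using e' True by (auto simp: full_lag_graph_def)
  next
    case False
    define l where "l = nat (t - s)"
    have l: "s = t - int l" "0 < l" "l \<le> \<gamma>max"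
      using False \<open>s \<le> t\<close> \<open>t - s \<le> int \<gamma>max\<close> by (auto simp: l_def)
    then have "(Past X, Present Y) \<in> escg_of \<gamma>max E"
      using e e' unfolding escg_of_def by blast
    then have "(Past X, Present Y) \<in> Ge" using Ge by simp
    then show ?thesis using e' l by (auto simp: full_lag_graph_def)
  qed
qed

text \<open>
A directed cycle stays within one instant, because no edge goes back in time. The instantaneous
edges are determined by the summary graph, so the cycle is also one of any candidate, which is
acyclic.
\<close>
lemma full_lag_graph_candidate:
  assumes "is_escg \<gamma>max Ge"
  shows "full_lag_graph \<gamma>max Ge \<in> candidates \<gamma>max Ge"
proof -
  let ?F = "full_lag_graph \<gamma>max Ge"
  obtain E where E: "is_ftcg \<gamma>max E" and Ge: "Ge = escg_of \<gamma>max E"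
    using assms by (auto simp: is_escg_def)
  have shift: "((X, s), (Y, t)) \<in> E \<longleftrightarrow> ((X, s + d), (Y, t + d)) \<in> E" for X s Y t d
    using E unfolding is_ftcg_def by blast
  have inst: "((X, t), (Y, t)) \<in> E" if edge: "(Present X, Present Y) \<in> Ge" for X Y t
  proof -
    obtain t' where "((X, t'), (Y, t')) \<in> E" using edge by (auto simp: Ge escg_of_def)
    then show ?thesis using shift[of X t' Y t' "t - t'"] by simp
  qed
  have acyc: "acyclic E" using E by (simp add: is_ftcg_def)
  have irr: "(Present X, Present X) \<notin> Ge" for X
    using inst[of X X 0] acyc by (auto simp: acyclic_def)
  have F_step: "snd u < snd v \<or> snd u = snd v \<and> (u, v) \<in> E" if "(u, v) \<in> ?F" for u v
    using that unfolding full_lag_graph_def by (auto intro: inst)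
  have step: "snd u < snd v \<or> snd u = snd v \<and> (u, v) \<in> E\<^sup>+" if "(u, v) \<in> ?F\<^sup>+" for u v
    using that
  proof (induction rule: trancl_induct)
    case (base v)
    then show ?case using F_step by blast
  next
    case (step v w)
    with step.IH F_step[OF step.hyps(2)] show ?case by (fastforce intro: trancl_into_trancl)
  qed
  then have "acyclic ?F" using acyc unfolding acyclic_def by blast
  moreover have "((X, s), (Y, t)) \<in> ?F \<longleftrightarrow> ((X, s + d), (Y, t + d)) \<in> ?F" for X s Y t d
    by (auto simp: full_lag_graph_def)
  ultimately have "is_ftcg \<gamma>max ?F"
    unfolding is_ftcg_def using irr by (auto simp: full_lag_graph_def)
  moreover have "escg_of \<gamma>max ?F = Ge"
  proof (intro equalityI subsetI)
    fix e assume "e \<in> escg_of \<gamma>max ?F"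
    then show "e \<in> Ge" unfolding escg_of_def full_lag_graph_def by auto
  next
    fix e assume e: "e \<in> Ge"
    then consider X Y where "e = (Present X, Present Y)"
      | X Y l where "e = (Past X, Present Y)" "0 < l" "l \<le> \<gamma>max"
      unfolding Ge escg_of_def by blast
    then show "e \<in> escg_of \<gamma>max ?F"
      using e by cases (auto simp: escg_of_def full_lag_graph_def)
  qed
  ultimately show ?thesis by (simp add: candidates_def)
qed

lemma densest_candidate_eq:
  assumes "is_escg \<gamma>max Ge"
  shows "densest_candidate \<gamma>max Ge = full_lag_graph \<gamma>max Ge"
  unfolding densest_candidate_def
  using full_lag_graph_candidate[OF assms] candidate_subset_full_lag_graph
  by (intro the_equality) (blast intro: equalityI)+

text \<open>
With this description of \<open>B_set\<close>, \<open>parents_backdoor_criterion\<close> applies to it.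
\<close>
lemma Par_full_lag_graph:
  "Par (X, t - int \<gamma>) (full_lag_graph \<gamma>max Ge) = B_set \<gamma>max Ge X t \<gamma>"
  by (auto simp: Par_def full_lag_graph_def B_set_def Suc_le_eq)

text \<open>
Countable additivity for families over arbitrary countable index sets, such as the possible
values of the adjustment set.
\<close>
lemma (in prob_space) infsum_prob_disjoint:
  assumes I: "countable I" and A: "\<And>i. i \<in> I \<Longrightarrow> A i \<in> events" and disj: "disjoint_family_on A I"
  shows "(\<Sum>\<^sub>\<infinity>i\<in>I. prob (A i)) = prob (\<Union>i\<in>I. A i)"
proof -
  have eq: "(\<integral>\<^sup>+i. ennreal (prob (A i)) \<partial>count_space I) = ennreal (prob (\<Union>i\<in>I. A i))"
    using emeasure_UN_countable[OF A I disj] by (simp add: emeasure_eq_measure)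
  have int: "integrable (count_space I) (\<lambda>i. prob (A i))"
    by (rule integrableI_nonneg) (simp_all add: eq)
  then have "(\<Sum>\<^sub>\<infinity>i\<in>I. prob (A i)) = infsetsum (\<lambda>i. prob (A i)) I"
    by (intro infsetsum_infsum[symmetric]) (simp add: abs_summable_on_def)
  also have "\<dots> = enn2real (\<integral>\<^sup>+i. ennreal (prob (A i)) \<partial>count_space I)"
    unfolding infsetsum_def by (rule integral_eq_nn_integral) simp_all
  also have "\<dots> = prob (\<Union>i\<in>I. A i)" by (simp add: eq)
  finally show ?thesis .
qed

section \<open>Solving the structural equations\<close>

locale stationary_scm =
  fixes D :: "('v::finite, 'a, 'u, 'w) dscm" and \<gamma>max :: nat
  assumes scm: "is_dscm D" and ftcg: "is_ftcg \<gamma>max (ftcg_of D)"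
begin

abbreviation E :: "'v ftgraph" where "E \<equiv> ftcg_of D"

sublocale prob_space "sample D" using scm by (simp add: is_dscm_def)

(* Quantifiers over variables stay unsplit, so that induction hypotheses match the variable at hand. *)
declare split_paired_All [simp del]

lemma acyclic_E: "acyclic E" using ftcg by (simp add: is_ftcg_def)

lemma edge_time: "(u, v) \<in> E \<Longrightarrow> snd u \<le> snd v"
  using ftcg unfolding is_ftcg_def by (metis prod.collapse)

lemma rtrancl_time: "(u, v) \<in> E\<^sup>* \<Longrightarrow> snd u \<le> snd v"
  by (induction rule: rtrancl_induct) (auto dest: edge_time)

lemma cause_edge: "c \<in> causes D (fst v) \<Longrightarrow> ((fst c, snd v - int (snd c)), v) \<in> E"
  unfolding ftcg_of_def by (cases c; cases v) auto

lemma finite_causes: "finite (causes D X)"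
proof (rule finite_subset)
  show "causes D X \<subseteq> UNIV \<times> {..\<gamma>max}"
  proof
    fix c assume "c \<in> causes D X"
    then have "((fst c, 0 - int (snd c)), (X, 0)) \<in> E" using cause_edge[of c "(X, 0)"] by simp
    then have "0 - (0 - int (snd c)) \<le> int \<gamma>max" using ftcg unfolding is_ftcg_def by blast
    then show "c \<in> UNIV \<times> {..\<gamma>max}" by (cases c) auto
  qed
qed simp

lemma structural_cong:
  assumes "\<And>u. (u, v) \<in> E \<Longrightarrow> V u \<omega> = V' u \<omega>"
  shows "structural_value D V v \<omega> = structural_value D V' v \<omega>"
proof -
  have "(\<lambda>c \<in> causes D (fst v). V (fst c, snd v - int (snd c)) \<omega>) =
        (\<lambda>c \<in> causes D (fst v). V' (fst c, snd v - int (snd c)) \<omega>)"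
    by (intro restrict_ext assms cause_edge)
  then show ?thesis unfolding structural_value_def by simp
qed

text \<open>
Although the past is infinite, recursion along the edges into variables from time \<open>T\<close> on is well
founded: an edge either moves to an earlier time, which can happen finitely often before \<open>T\<close> is
passed, or follows the instantaneous edges, which form a finite acyclic graph.
\<close>
lemma wf_from_time: "wf {(u, v) \<in> E. T \<le> snd v}"
proof -
  define I where "I = {(X, Y). (X, 0) \<in> causes D Y}"
  have "((X, 0), (Y, 0)) \<in> E\<^sup>+" if "(X, Y) \<in> I\<^sup>+" for X Y
    using that
  proof (induction rule: trancl_induct)
    case (base Y)
    then show ?case using cause_edge[of "(X, 0)" "(Y, 0)"] by (auto simp: I_def)
  next
    case (step Y Z)
    then show ?case using cause_edge[of "(Y, 0)" "(Z, 0)"] by (auto simp: I_def intro: trancl_into_trancl)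
  qed
  then have "acyclic I" using acyclic_E by (auto simp: acyclic_def)
  then have "wf I" by (intro finite_acyclic_wf) simp
  then have "wf (inv_image (less_than <*lex*> I) (\<lambda>(X, t). (nat (t - T + 1), X)))" by auto
  then show ?thesis
  proof (rule wf_subset, clarify)
    fix X s Y t assume "((X, s), (Y, t)) \<in> E" and T: "T \<le> snd (Y, t)"
    then obtain l where l: "s = t - int l" "(X, l) \<in> causes D Y" by (auto simp: ftcg_of_def)
    then show "((X, s), (Y, t)) \<in> inv_image (less_than <*lex*> I) (\<lambda>(X, t). (nat (t - T + 1), X))"
      using T by (cases l) (auto simp: I_def)
  qed
qed

text \<open>
The right-hand side \<open>F\<close> need not be the structural equations of the model: an intervention overrides
one of them, and the pinned process below changes their arguments.
\<close>
lemma recursion: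
  fixes F :: "('v tvar \<Rightarrow> 'w \<Rightarrow> 'a) \<Rightarrow> 'v tvar \<Rightarrow> 'w \<Rightarrow> 'a"
  assumes cong: "\<And>V V' v. (\<And>u. (u, v) \<in> E \<Longrightarrow> V u = V' u) \<Longrightarrow> F V v = F V' v"
  shows "\<exists>!V. \<forall>v. V v = (if snd v < T then V0 v else F V v)"
proof -
  let ?R = "{(u, v) \<in> E. T \<le> snd v}"
  let ?G = "\<lambda>V v. if snd v < T then V0 v else F V v"
  have "adm_wf ?R ?G" unfolding adm_wf_def
  proof (intro allI impI)
    fix V V' :: "'v tvar \<Rightarrow> 'w \<Rightarrow> 'a" and v
    assume "\<forall>u. (u, v) \<in> ?R \<longrightarrow> V u = V' u"
    then show "?G V v = ?G V' v" using cong[of v V V'] by simp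
  qed
  then have "wfrec ?R ?G = ?G (wfrec ?R ?G)" by (rule wfrec_fixpoint[OF wf_from_time])
  moreover have "V = V'" if V: "\<forall>v. V v = ?G V v" and V': "\<forall>v. V' v = ?G V' v" for V V'
  proof
    fix v show "V v = V' v"
    proof (induction v rule: wf_induct[OF wf_from_time[of T]])
      case (1 v)
      then have "F V v = F V' v" if "T \<le> snd v" using cong[of v V V'] that by simp
      then show ?case using V[rule_format, of v] V'[rule_format, of v] by auto
    qed
  qed
  ultimately show ?thesis by (metis (no_types, lifting))
qed

lemma do_obs_eq:
  "snd v < snd a \<Longrightarrow> do_obs D a x v = obs D v"
  "do_obs D a x a = (\<lambda>_. x)"
  "snd a \<le> snd v \<Longrightarrow> v \<noteq> a \<Longrightarrow> do_obs D a x v = structural_value D (do_obs D a x) v"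
proof -
  let ?P = "\<lambda>V. (\<forall>v. snd v < snd a \<longrightarrow> V v = obs D v) \<and> V a = (\<lambda>_. x) \<and>
     (\<forall>v. snd a \<le> snd v \<and> v \<noteq> a \<longrightarrow> V v = structural_value D V v)"
  let ?F = "\<lambda>V v. if v = a then (\<lambda>_. x) else structural_value D V v"
  have "\<exists>!V. \<forall>v. V v = (if snd v < snd a then obs D v else ?F V v)"
    by (rule recursion) (auto intro!: ext structural_cong)
  moreover have "(\<forall>v. V v = (if snd v < snd a then obs D v else ?F V v)) \<longleftrightarrow> ?P V" for V
    by (auto simp: not_less simp del: split_paired_All)
  ultimately have "\<exists>!V. ?P V" by simp
  from theI'[OF this] have "?P (do_obs D a x)" unfolding do_obs_def .
  then show "snd v < snd a \<Longrightarrow> do_obs D a x v = obs D v"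
    "do_obs D a x a = (\<lambda>_. x)"
    "snd a \<le> snd v \<Longrightarrow> v \<noteq> a \<Longrightarrow> do_obs D a x v = structural_value D (do_obs D a x) v"
    by blast+
qed

lemma obs_structural: "\<omega> \<in> space (sample D) \<Longrightarrow> obs D v \<omega> = structural_value D (obs D) v \<omega>"
  using scm unfolding is_dscm_def by blast

lemma do_obs_nondescendant:
  assumes "\<omega> \<in> space (sample D)" "(a, v) \<notin> E\<^sup>*"
  shows "do_obs D a x v \<omega> = obs D v \<omega>"
  using assms(2)
proof (induction v rule: wf_induct[OF wf_from_time[of "snd a"]])
  case (1 v)
  show ?case
  proof (cases "snd v < snd a")
    case False
    have "structural_value D (do_obs D a x) v \<omega> = structural_value D (obs D) v \<omega>"
    proof (rule structural_cong)
      fix u assume u: "(u, v) \<in> E"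
      then have "(a, u) \<notin> E\<^sup>*" using 1(2) by (meson rtrancl_into_rtrancl)
      then show "do_obs D a x u \<omega> = obs D u \<omega>" using 1(1) u False by simp
    qed
    then show ?thesis using do_obs_eq(3)[of a v x] obs_structural[OF assms(1), of v] False 1(2)
      by (cases "v = a") auto
  qed (simp add: do_obs_eq)
qed

text \<open>
Consistency of counterfactuals: forcing the value that \<open>a\<close> takes anyway changes nothing.
\<close>
lemma do_obs_consistent:
  assumes "\<omega> \<in> space (sample D)" "obs D a \<omega> = x"
  shows "do_obs D a x v \<omega> = obs D v \<omega>"
proof (induction v rule: wf_induct[OF wf_from_time[of "snd a"]])
  case (1 v)
  consider "snd v < snd a" | "v = a" | "snd a \<le> snd v" "v \<noteq> a" by linarith
  then show ?case
  proof cases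
    case 3
    have "structural_value D (do_obs D a x) v \<omega> = structural_value D (obs D) v \<omega>"
      using 1 3 by (intro structural_cong) auto
    then show ?thesis using do_obs_eq(3)[OF 3] obs_structural[OF assms(1)] by simp
  qed (simp_all add: do_obs_eq assms)
qed

text \<open>
The process in which every structural equation reads the fixed value \<open>s u\<close> in place of each argument
\<open>u\<close> in \<open>S\<close>, while the variables in \<open>S\<close> themselves still follow their own equations. Unlike an
intervention this cuts the edges out of \<open>S\<close>, not those into it. The observed process serves as the
past before \<open>T\<close>, where \<open>T\<close> is chosen not to exceed any time in \<open>S\<close>.
\<close>
definition pinned :: "'v tvar set \<Rightarrow> ('v tvar \<Rightarrow> 'a) \<Rightarrow> int \<Rightarrow> 'v tvar \<Rightarrow> 'w \<Rightarrow> 'a" where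
  "pinned S s T = (THE V. \<forall>v. V v =
     (if snd v < T then obs D v
      else structural_value D (\<lambda>u. if u \<in> S then (\<lambda>_. s u) else V u) v))"

lemma pinned_eq:
  "pinned S s T v = (if snd v < T then obs D v
     else structural_value D (\<lambda>u. if u \<in> S then (\<lambda>_. s u) else pinned S s T u) v)"
proof -
  have "\<exists>!V. \<forall>v. V v = (if snd v < T then obs D v
      else structural_value D (\<lambda>u. if u \<in> S then (\<lambda>_. s u) else V u) v)"
    by (rule recursion) (auto intro!: ext structural_cong)
  from theI'[OF this] show ?thesis unfolding pinned_def by blast
qed

text \<open>
If the variables in \<open>Z\<close> take the pinned values anyway, pinning can only be felt through \<open>a\<close>, so not
at variables that are no proper descendants of \<open>a\<close>. The disjunctive assumption shows that the two
events that \<open>Z\<close> takes these values, in the observed and in the pinned process, are the same event.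
\<close>
lemma pinned_obs:
  assumes \<omega>: "\<omega> \<in> space (sample D)"
    and Z: "(\<forall>z \<in> Z. obs D z \<omega> = s z) \<or> (\<forall>z \<in> Z. pinned (insert a Z) s T z \<omega> = s z)"
    and v: "(a, v) \<notin> E\<^sup>+"
  shows "pinned (insert a Z) s T v \<omega> = obs D v \<omega>"
  using v
proof (induction v rule: wf_induct[OF wf_from_time[of T]])
  case (1 v)
  show ?case
  proof (cases "snd v < T")
    case False
    have "structural_value D (\<lambda>u. if u \<in> insert a Z then (\<lambda>_. s u) else pinned (insert a Z) s T u) v \<omega>
        = structural_value D (obs D) v \<omega>"
    proof (rule structural_cong)
      fix u assume u: "(u, v) \<in> E"
      then have "u \<noteq> a" "(a, u) \<notin> E\<^sup>+" using 1(2) by (auto intro: trancl_into_trancl)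
      moreover have "pinned (insert a Z) s T u \<omega> = obs D u \<omega>"
        using 1(1) u False \<open>(a, u) \<notin> E\<^sup>+\<close> by auto
      ultimately show "(if u \<in> insert a Z then (\<lambda>_. s u) else pinned (insert a Z) s T u) \<omega> = obs D u \<omega>"
        using Z by auto
    qed
    then show ?thesis
      using pinned_eq[of "insert a Z" s T v] obs_structural[OF \<omega>] False by simp
  qed (simp add: pinned_eq)
qed

text \<open>
If the variables in \<open>Z\<close> take the pinned values, the only effect of pinning is that the children of
\<open>a\<close> read \<open>s a\<close>, as they do under the intervention. At \<open>a\<close> the two processes differ, since the pinned
one keeps the natural value of \<open>a\<close>.
\<close>
lemma pinned_do_obs:
  assumes \<omega>: "\<omega> \<in> space (sample D)"
    and Z: "\<forall>z \<in> Z. pinned (insert a Z) s T z \<omega> = s z"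
    and T: "T \<le> snd a" and v: "v \<noteq> a"
  shows "do_obs D a (s a) v \<omega> = pinned (insert a Z) s T v \<omega>"
  using v
proof (induction v rule: wf_induct[OF wf_from_time[of "snd a"]])
  case (1 v)
  show ?case
  proof (cases "snd v < snd a")
    case True
    then have "(a, v) \<notin> E\<^sup>+" using rtrancl_time[of a v] by (auto dest: trancl_into_rtrancl)
    then show ?thesis using pinned_obs[OF \<omega>] Z True by (simp add: do_obs_eq)
  next
    case False
    have "structural_value D (do_obs D a (s a)) v \<omega> =
      structural_value D (\<lambda>u. if u \<in> insert a Z then (\<lambda>_. s u) else pinned (insert a Z) s T u) v \<omega>"
    proof (rule structural_cong)
      fix u assume u: "(u, v) \<in> E"
      show "do_obs D a (s a) u \<omega> =
          (if u \<in> insert a Z then (\<lambda>_. s u) else pinned (insert a Z) s T u) \<omega>"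
      proof (cases "u = a")
        case False
        then have "do_obs D a (s a) u \<omega> = pinned (insert a Z) s T u \<omega>"
          using 1(1) u \<open>\<not> snd v < snd a\<close> by auto
        then show ?thesis using False Z by auto
      qed (simp add: do_obs_eq)
    qed
    then show ?thesis
      using do_obs_eq(3)[of a v "s a"] pinned_eq[of "insert a Z" s T v] False 1(2) T by simp
  qed
qed

section \<open>Independence from disjoint sets of exogenous variables\<close>

text \<open>
The events that are determined by the exogenous variables with index in \<open>N\<close>.
\<close>
definition noise_algebra :: "'v tvar set \<Rightarrow> 'w measure" where
  "noise_algebra N = vimage_algebra (space (sample D)) (\<lambda>\<omega>. \<lambda>w \<in> N. noise D w \<omega>)
     (\<Pi>\<^sub>M w \<in> N. noise_law D (fst w))"

lemma space_noise_algebra [simp]: "space (noise_algebra N) = space (sample D)"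
  by (simp add: noise_algebra_def)

lemma indep_noise: "indep_vars (\<lambda>v. noise_law D (fst v)) (noise D) UNIV"
  using scm by (simp add: is_dscm_def)

lemma measurable_noise: "noise D v \<in> sample D \<rightarrow>\<^sub>M noise_law D (fst v)"
  using indep_noise by (simp add: indep_vars_def)

lemma noise_in_space:
  "\<omega> \<in> space (sample D) \<Longrightarrow> noise D v \<omega> \<in> space (noise_law D (fst v))"
  using measurable_noise by (rule measurable_space)

lemma measurable_noise_tuple:
  "(\<lambda>\<omega>. \<lambda>w \<in> N. noise D w \<omega>) \<in> noise_algebra N \<rightarrow>\<^sub>M (\<Pi>\<^sub>M w \<in> N. noise_law D (fst w))"
  unfolding noise_algebra_def
  by (intro measurable_vimage_algebra1 funcsetI) (simp add: space_PiM noise_in_space)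

lemma measurable_noise_algebra_noise:
  assumes "v \<in> N"
  shows "noise D v \<in> noise_algebra N \<rightarrow>\<^sub>M noise_law D (fst v)"
proof -
  have "(\<lambda>\<omega>. (\<lambda>w \<in> N. noise D w \<omega>) v) \<in> noise_algebra N \<rightarrow>\<^sub>M noise_law D (fst v)"
    by (rule measurable_compose[OF measurable_noise_tuple
          measurable_component_singleton[OF assms, where M="\<lambda>w. noise_law D (fst w)"]])
  then show ?thesis using assms by simp
qed

lemma noise_algebra_mono:
  assumes "N \<subseteq> N'"
  shows "sets (noise_algebra N) \<subseteq> sets (noise_algebra N')"
  unfolding noise_algebra_def[of N]
  using assms
  by (intro sets_image_in_sets measurable_restrict measurable_noise_algebra_noise) auto

lemma noise_algebra_events: "sets (noise_algebra N) \<subseteq> events"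
  unfolding noise_algebra_def
  by (intro sets_image_in_sets measurable_restrict measurable_noise refl)

lemma noise_algebra_indep:
  assumes A: "A \<in> sets (noise_algebra N)" and B: "B \<in> sets (noise_algebra N')"
    and disj: "N \<inter> N' = {}"
  shows "prob (A \<inter> B) = prob A * prob B"
proof -
  have tuple: "(\<lambda>\<omega>. \<lambda>w \<in> K. noise D w \<omega>) \<in> space (sample D) \<rightarrow> space (\<Pi>\<^sub>M w \<in> K. noise_law D (fst w))" for K
    by (intro funcsetI) (simp add: space_PiM noise_in_space)
  obtain A' where A': "A' \<in> sets (\<Pi>\<^sub>M w \<in> N. noise_law D (fst w))"
      "A = (\<lambda>\<omega>. \<lambda>w \<in> N. noise D w \<omega>) -` A' \<inter> space (sample D)"
    using A unfolding noise_algebra_def sets_vimage_algebra2[OF tuple] by blast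
  obtain B' where B': "B' \<in> sets (\<Pi>\<^sub>M w \<in> N'. noise_law D (fst w))"
      "B = (\<lambda>\<omega>. \<lambda>w \<in> N'. noise D w \<omega>) -` B' \<inter> space (sample D)"
    using B unfolding noise_algebra_def sets_vimage_algebra2[OF tuple] by blast
  have "A \<inter> B = (\<lambda>\<omega>. (\<lambda>w \<in> N. noise D w \<omega>, \<lambda>w \<in> N'. noise D w \<omega>)) -` (A' \<times> B') \<inter> space (sample D)"
    unfolding A' B' by auto
  also have "prob \<dots> = prob A * prob B"
    unfolding A'(2) B'(2)
    by (rule indep_varD[OF indep_var_restrict[OF indep_noise disj] A'(1) B'(1)]) auto
  finally show ?thesis .
qed

lemma countable_states: "countable (states D X)"
  using scm by (simp add: is_dscm_def)

text \<open>
Mechanisms are required to be measurable in the exogenous variable only for fixed arguments; as the arguments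
range over a countable set, this suffices.
\<close>
lemma measurable_structural_value:
  assumes v: "v \<in> N"
    and V: "\<And>u. (u, v) \<in> E \<Longrightarrow> V u \<in> noise_algebra N \<rightarrow>\<^sub>M count_space (states D (fst u))"
  shows "structural_value D V v \<in> noise_algebra N \<rightarrow>\<^sub>M count_space (states D (fst v))"
proof -
  let ?C = "causes D (fst v)" and ?I = "\<Pi>\<^sub>E c \<in> causes D (fst v). states D (fst c)"
  let ?g = "\<lambda>\<omega>. \<lambda>c \<in> ?C. V (fst c, snd v - int (snd c)) \<omega>"
  have I: "countable ?I" by (intro countable_PiE finite_causes countable_states)
  have Vc: "V (fst c, snd v - int (snd c)) \<in> noise_algebra N \<rightarrow>\<^sub>M count_space (states D (fst c))"
    if "c \<in> ?C" for c
    using V[OF cause_edge[OF that]] by simp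
  have g: "?g \<in> noise_algebra N \<rightarrow>\<^sub>M count_space ?I"
    unfolding measurable_count_space_eq_countable[OF I]
  proof (intro conjI ballI funcsetI)
    fix \<omega> assume "\<omega> \<in> space (noise_algebra N)"
    then show "?g \<omega> \<in> ?I" using measurable_space[OF Vc] by auto
  next
    fix h assume h: "h \<in> ?I"
    have "?g -` {h} \<inter> space (noise_algebra N) =
       {\<omega> \<in> space (noise_algebra N). \<forall>c \<in> ?C. V (fst c, snd v - int (snd c)) \<omega> = h c}"
    proof -
      have "?g \<omega> = h \<longleftrightarrow> (\<forall>c \<in> ?C. V (fst c, snd v - int (snd c)) \<omega> = h c)" for \<omega>
        using h by (metis (no_types, lifting) PiE_restrict restrict_apply' restrict_ext)
      then show ?thesis by auto
    qed
    also have "\<dots> \<in> sets (noise_algebra N)"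
    proof (intro sets.sets_Collect_finite_All finite_causes)
      fix c assume c: "c \<in> ?C"
      have "V (fst c, snd v - int (snd c)) -` {h c} \<inter> space (noise_algebra N) \<in> sets (noise_algebra N)"
        using c h by (intro measurable_sets[OF Vc[OF c]]) auto
      then show "{\<omega> \<in> space (noise_algebra N). V (fst c, snd v - int (snd c)) \<omega> = h c} \<in> sets (noise_algebra N)"
        by (simp add: vimage_def Int_def conj_commute)
    qed
    finally show "?g -` {h} \<inter> space (noise_algebra N) \<in> sets (noise_algebra N)" .
  qed
  have mech: "(\<lambda>\<omega>. mech D (fst v) h (noise D v \<omega>)) \<in> noise_algebra N \<rightarrow>\<^sub>M count_space (states D (fst v))"
    if "h \<in> ?I" for h
    using scm that unfolding is_dscm_def
    by (intro measurable_compose[OF measurable_noise_algebra_noise[OF v]]) blast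
  show ?thesis
    unfolding structural_value_def
    by (rule measurable_compose_countable'[OF mech g I])
qed

lemma measurable_obs:
  "obs D v \<in> noise_algebra {w. (w, v) \<in> E\<^sup>*} \<rightarrow>\<^sub>M count_space (states D (fst v))"
proof -
  let ?N = "{w. (w, v) \<in> E\<^sup>*}"
  obtain g where g: "g \<in> (\<Pi>\<^sub>M w \<in> ?N. noise_law D (fst w)) \<rightarrow>\<^sub>M count_space (states D (fst v))"
    and eq: "\<And>\<omega>. \<omega> \<in> space (sample D) \<Longrightarrow> obs D v \<omega> = g (\<lambda>w \<in> ?N. noise D w \<omega>)"
    using scm[unfolded is_dscm_def, THEN conjunct2, THEN conjunct2, THEN conjunct2,
        THEN conjunct2, THEN conjunct2, THEN conjunct2, THEN spec[of _ v]] by blast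
  have "(\<lambda>\<omega>. g (\<lambda>w \<in> ?N. noise D w \<omega>)) \<in> noise_algebra ?N \<rightarrow>\<^sub>M count_space (states D (fst v))"
    by (rule measurable_compose[OF measurable_noise_tuple g])
  moreover have "obs D v \<in> noise_algebra ?N \<rightarrow>\<^sub>M count_space (states D (fst v)) \<longleftrightarrow>
      (\<lambda>\<omega>. g (\<lambda>w \<in> ?N. noise D w \<omega>)) \<in> noise_algebra ?N \<rightarrow>\<^sub>M count_space (states D (fst v))"
    by (rule measurable_cong) (simp add: eq)
  ultimately show ?thesis by blast
qed

text \<open>
The induction starts at the variables before \<open>T\<close>, which are observed variables and depend on
the exogenous variables of all of their ancestors. None of these ancestors is in \<open>S\<close>, so they are
still ancestors after the edges out of \<open>S\<close> have been removed.
\<close>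
lemma measurable_pinned:
  assumes T: "\<And>u. u \<in> S \<Longrightarrow> T \<le> snd u" and s: "\<And>u. u \<in> S \<Longrightarrow> s u \<in> states D (fst u)"
  shows "pinned S s T v \<in> noise_algebra {w. (w, v) \<in> (cut_out S E)\<^sup>*}
           \<rightarrow>\<^sub>M count_space (states D (fst v))"
proof (induction v rule: wf_induct[OF wf_from_time[of T]])
  case (1 v)
  let ?N = "\<lambda>v. {w. (w, v) \<in> (cut_out S E)\<^sup>*}"
  show ?case
  proof (cases "snd v < T")
    case True
    have "(w, v) \<in> (cut_out S E)\<^sup>*" if "(w, v) \<in> E\<^sup>*" for w
      using that
    proof (induction rule: converse_rtrancl_induct)
      case (step w u)
      have "snd w < T" 
        using rtrancl_time[OF converse_rtrancl_into_rtrancl[OF step.hyps]] True by simp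
      then have "(w, u) \<in> cut_out S E" 
        using step.hyps(1) T[of w] by (auto simp: cut_out_def)
      then show ?case using step.IH by (rule converse_rtrancl_into_rtrancl)
    qed simp
    then have "sets (noise_algebra {w. (w, v) \<in> E\<^sup>*}) \<subseteq> sets (noise_algebra (?N v))"
      by (intro noise_algebra_mono) blast
    then show ?thesis
      using measurable_obs[of v] True measurable_mono[OF order_refl refl _ , of "noise_algebra {w. (w, v) \<in> E\<^sup>*}" "noise_algebra (?N v)"]
      by (auto simp: pinned_eq)
  next
    case False
    have "structural_value D (\<lambda>u. if u \<in> S then (\<lambda>_. s u) else pinned S s T u) v
        \<in> noise_algebra (?N v) \<rightarrow>\<^sub>M count_space (states D (fst v))"
    proof (rule measurable_structural_value)
      fix u assume u: "(u, v) \<in> E"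
      show "(if u \<in> S then (\<lambda>_. s u) else pinned S s T u)
          \<in> noise_algebra (?N v) \<rightarrow>\<^sub>M count_space (states D (fst u))"
      proof (cases "u \<in> S")
        case True
        then show ?thesis using s by simp
      next
        case uS: False
        then have "(u, v) \<in> cut_out S E" using u by (simp add: cut_out_def)
        then have "sets (noise_algebra (?N u)) \<subseteq> sets (noise_algebra (?N v))"
          by (intro noise_algebra_mono) (auto intro: rtrancl_into_rtrancl)
        moreover have "pinned S s T u \<in> noise_algebra (?N u) \<rightarrow>\<^sub>M count_space (states D (fst u))"
          using 1 u False by auto
        ultimately show ?thesis
          using uS measurable_mono[OF order_refl refl _ , of "noise_algebra (?N u)" "noise_algebra (?N v)"]
          by auto
      qed
    qed simp
    then show ?thesis using False by (subst pinned_eq) simp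
  qed
qed

lemma pinned_events:
  assumes "finite U" "\<And>u. u \<in> U \<Longrightarrow> r u \<in> states D (fst u)"
    and T: "\<And>u. u \<in> S \<Longrightarrow> T \<le> snd u" and s: "\<And>u. u \<in> S \<Longrightarrow> s u \<in> states D (fst u)"
  shows "{\<omega> \<in> space (sample D). \<forall>u \<in> U. pinned S s T u \<omega> = r u}
     \<in> sets (noise_algebra {w. \<exists>u \<in> U. (w, u) \<in> (cut_out S E)\<^sup>*})"
    (is "_ \<in> sets (noise_algebra ?N)")
proof -
  have "{\<omega> \<in> space (noise_algebra ?N). pinned S s T u \<omega> = r u} \<in> sets (noise_algebra ?N)"
    if u: "u \<in> U" for u
  proof -
    let ?Nu = "{w. (w, u) \<in> (cut_out S E)\<^sup>*}"
    have "pinned S s T u -` {r u} \<inter> space (noise_algebra ?Nu) \<in> sets (noise_algebra ?Nu)"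
      using u assms(2) by (intro measurable_sets[OF measurable_pinned[OF T s]]) auto
    moreover have "pinned S s T u -` {r u} \<inter> space (noise_algebra ?Nu) =
        {\<omega> \<in> space (noise_algebra ?N). pinned S s T u \<omega> = r u}"
      by auto
    moreover have "sets (noise_algebra ?Nu) \<subseteq> sets (noise_algebra ?N)"
      using u by (intro noise_algebra_mono) blast
    ultimately show ?thesis by auto
  qed
  then have "{\<omega> \<in> space (noise_algebra ?N). \<forall>u \<in> U. pinned S s T u \<omega> = r u} \<in> sets (noise_algebra ?N)"
    using assms(1) by (intro sets.sets_Collect_finite_All)
  then show ?thesis by simp
qed

text \<open>
Families of pinned variables without a link between them depend on disjoint sets of exogenous
variables.
\<close>
lemma pinned_indep:
  assumes "finite U" "finite U'" "\<And>u. u \<in> U \<union> U' \<Longrightarrow> r u \<in> states D (fst u)"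
    and T: "\<And>u. u \<in> S \<Longrightarrow> T \<le> snd u" and s: "\<And>u. u \<in> S \<Longrightarrow> s u \<in> states D (fst u)"
    and unlinked: "\<And>u u'. u \<in> U \<Longrightarrow> u' \<in> U' \<Longrightarrow> \<not> linked (cut_out S E) u u'"
  shows "\<P>(\<omega> in sample D. \<forall>u \<in> U \<union> U'. pinned S s T u \<omega> = r u) =
     \<P>(\<omega> in sample D. \<forall>u \<in> U. pinned S s T u \<omega> = r u) *
     \<P>(\<omega> in sample D. \<forall>u \<in> U'. pinned S s T u \<omega> = r u)"
proof -
  have "{\<omega> \<in> space (sample D). \<forall>u \<in> U \<union> U'. pinned S s T u \<omega> = r u} =
    {\<omega> \<in> space (sample D). \<forall>u \<in> U. pinned S s T u \<omega> = r u} \<inter>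
    {\<omega> \<in> space (sample D). \<forall>u \<in> U'. pinned S s T u \<omega> = r u}"
    by blast
  moreover have "{w. \<exists>u \<in> U. (w, u) \<in> (cut_out S E)\<^sup>*} \<inter> {w. \<exists>u \<in> U'. (w, u) \<in> (cut_out S E)\<^sup>*} = {}"
    using unlinked unfolding linked_def by blast
  ultimately show ?thesis
    using noise_algebra_indep[OF pinned_events[OF assms(1) _ T s] pinned_events[OF assms(2) _ T s]]
      assms(3) by simp
qed

text \<open>
Conditional independence of the pinned variables \<open>a\<close> and \<open>b\<close> given those in \<open>Z\<close>, with all
denominators cleared. The component \<open>K\<close> of \<open>a\<close> is independent of \<open>b\<close> together with the rest of \<open>Z\<close>,
so each of the four probabilities is a product of a factor for \<open>K\<close> and a factor for the rest, and
both sides consist of the same four factors.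
\<close>
lemma pinned_cond_indep:
  assumes Z: "finite Z" and bd: "backdoor_criterion E a b Z" and ab: "a \<noteq> b" "b \<notin> Z"
    and r: "\<And>u. u \<in> insert b (insert a Z) \<Longrightarrow> r u \<in> states D (fst u)"
    and T: "\<And>u. u \<in> insert a Z \<Longrightarrow> T \<le> snd u"
  defines "p \<equiv> \<lambda>U. \<P>(\<omega> in sample D. \<forall>u \<in> U. pinned (insert a Z) r T u \<omega> = r u)"
  shows "p (insert b (insert a Z)) * p Z = p (insert a Z) * p (insert b Z)"
proof -
  let ?G = "cut_out (insert a Z) E"
  define K where "K = component ?G Z a"
  have K: "K \<subseteq> insert a Z" "a \<in> K"
    unfolding K_def by (rule component_subset, rule component.start)
  have aZ: "a \<notin> Z" using bd unfolding backdoor_criterion_def by blast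
  have fin: "finite K" using K(1) Z by (auto intro: finite_subset)
  have unlinked: "\<not> linked ?G u u'" if "u \<in> K" "u' \<in> insert b (Z - K)" for u u'
  proof (cases "u' = b")
    case True
    then show ?thesis
      using backdoor_criterion_not_linked[OF acyclic_E bd ab] that(1) by (simp add: K_def)
  next
    case False
    then show ?thesis using that component.step[of u ?G Z a u'] by (auto simp: K_def)
  qed
  have split: "p (U \<union> U') = p U * p U'" if U: "U \<subseteq> K" "U' \<subseteq> insert b (Z - K)" for U U'
    unfolding p_def
  proof (rule pinned_indep)
    show "finite U" "finite U'" using U fin Z by (auto intro: finite_subset)
    show "r u \<in> states D (fst u)" if "u \<in> U \<union> U'" for u
      using that U K(1) by (intro r) blast
    show "r u \<in> states D (fst u)" if "u \<in> insert a Z" for u using that by (intro r) blast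
    show "\<not> linked ?G u u'" if "u \<in> U" "u' \<in> U'" for u u' using that U unlinked by blast
  qed (rule T)
  have "p (insert b (insert a Z)) = p K * p (insert b (Z - K))"
    by (subst split[symmetric]) (use K in \<open>auto intro: arg_cong[where f=p]\<close>)
  moreover have "p Z = p (K - {a}) * p (Z - K)"
    by (subst split[symmetric]) (use K aZ in \<open>auto intro!: arg_cong[where f=p]\<close>)
  moreover have "p (insert a Z) = p K * p (Z - K)"
    by (subst split[symmetric]) (use K in \<open>auto intro!: arg_cong[where f=p]\<close>)
  moreover have "p (insert b Z) = p (K - {a}) * p (insert b (Z - K))"
    by (subst split[symmetric]) (use K aZ in \<open>auto intro!: arg_cong[where f=p]\<close>)
  ultimately show ?thesis by simp
qed

section \<open>The adjustment formula\<close>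

lemma random_variable_obs: "obs D v \<in> sample D \<rightarrow>\<^sub>M count_space (states D (fst v))"
  using measurable_obs[of v] noise_algebra_events[of "{w. (w, v) \<in> E\<^sup>*}"]
  by (auto simp: measurable_def)

lemma obs_event:
  assumes "finite U"
  shows "{\<omega> \<in> space (sample D). \<forall>u \<in> U. obs D u \<omega> = z u} \<in> events"
proof (intro sets.sets_Collect_finite_All assms)
  fix u
  have "obs D u -` ({z u} \<inter> states D (fst u)) \<inter> space (sample D) \<in> events"
    by (intro measurable_sets[OF random_variable_obs]) auto
  moreover have "obs D u -` ({z u} \<inter> states D (fst u)) \<inter> space (sample D) =
      {\<omega> \<in> space (sample D). obs D u \<omega> = z u}"
    using measurable_space[OF random_variable_obs[of u]] by auto
  ultimately show "{\<omega> \<in> space (sample D). obs D u \<omega> = z u} \<in> events" by simp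
qed

text \<open>
The adjustment formula holds value by value of \<open>Z\<close>. In the main case all four events involved
are events of the pinned process: the variables in \<open>Z\<close> and \<open>a\<close> agree with the observed ones, \<open>b\<close>
agrees with its value under the intervention, and where \<open>a\<close> takes the value \<open>x\<close> that value is also
the observed one. If \<open>b\<close> is in \<open>Z\<close>, it is no descendant of \<open>a\<close> and its value is fixed by that of \<open>Z\<close>,
so both sides are the probability of that value of \<open>Z\<close> or zero. Positivity is what makes the
conditional probabilities meaningful.
\<close>
lemma adjustment_term:
  assumes pos: "positive_dscm D" and Z: "finite Z" and bd: "backdoor_criterion E a b Z"
    and ab: "a \<noteq> b" and x: "x \<in> states D (fst a)" and y: "y \<in> states D (fst b)"
    and z: "z \<in> (\<Pi>\<^sub>E v \<in> Z. states D (fst v))"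
  shows "{\<omega> \<in> space (sample D). do_obs D a x b \<omega> = y \<and> (\<forall>v \<in> Z. obs D v \<omega> = z v)} \<in> events" (is ?ev)
    and "\<P>(\<omega> in sample D. obs D b \<omega> = y \<bar> obs D a \<omega> = x \<and> (\<forall>v \<in> Z. obs D v \<omega> = z v)) *
         \<P>(\<omega> in sample D. \<forall>v \<in> Z. obs D v \<omega> = z v) =
         \<P>(\<omega> in sample D. do_obs D a x b \<omega> = y \<and> (\<forall>v \<in> Z. obs D v \<omega> = z v))" (is ?eq)
proof -
  have nd: "(a, v) \<notin> E\<^sup>*" if "v \<in> Z" for v
    using bd that unfolding backdoor_criterion_def by blast
  then have aZ: "a \<notin> Z" by blast
  \<comment> \<open>The variables in \<open>insert a Z\<close> are pinned to \<open>r\<close>; the value \<open>y\<close> matters at \<open>b\<close> only.\<close>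
  define r where "r = (\<lambda>u. if u = a then x else if u \<in> Z then z u else y)"
  have ra: "r a = x" and rZ: "\<And>u. u \<in> Z \<Longrightarrow> r u = z u" using aZ by (auto simp: r_def)
  have r: "r u \<in> states D (fst u)" if "u \<in> insert b (insert a Z)" for u
    using that x y z aZ by (auto simp: r_def PiE_iff)
  have "restrict r (insert a Z) \<in> (\<Pi>\<^sub>E v \<in> insert a Z. states D (fst v))" using r by auto
  then have "\<P>(\<omega> in sample D. \<forall>v \<in> insert a Z. obs D v \<omega> = restrict r (insert a Z) v) > 0"
    using pos Z unfolding positive_dscm_def by blast
  moreover have "(\<forall>v \<in> insert a Z. obs D v \<omega> = restrict r (insert a Z) v) \<longleftrightarrow>
      obs D a \<omega> = x \<and> (\<forall>v \<in> Z. obs D v \<omega> = z v)" for \<omega>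
    using ra rZ by auto
  ultimately have pos': "\<P>(\<omega> in sample D. obs D a \<omega> = x \<and> (\<forall>v \<in> Z. obs D v \<omega> = z v)) > 0"
    by simp
  have "?ev \<and> ?eq"
  proof (cases "b \<in> Z")
    case True
    then have same: "do_obs D a x b \<omega> = obs D b \<omega>" if "\<omega> \<in> space (sample D)" for \<omega>
      using do_obs_nondescendant[OF that nd] by blast
    show ?thesis
    proof (cases "z b = y")
      case True
      have "{\<omega> \<in> space (sample D). do_obs D a x b \<omega> = y \<and> (\<forall>v \<in> Z. obs D v \<omega> = z v)} =
          {\<omega> \<in> space (sample D). \<forall>v \<in> Z. obs D v \<omega> = z v}"
        using same \<open>b \<in> Z\<close> True by auto
      moreover have "{\<omega> \<in> space (sample D). obs D b \<omega> = y \<and> obs D a \<omega> = x \<and> (\<forall>v \<in> Z. obs D v \<omega> = z v)} =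
          {\<omega> \<in> space (sample D). obs D a \<omega> = x \<and> (\<forall>v \<in> Z. obs D v \<omega> = z v)}"
        using \<open>b \<in> Z\<close> True by auto
      ultimately show ?thesis using pos' obs_event[OF Z] by (simp add: cond_prob_def)
    next
      case False
      then have "{\<omega> \<in> space (sample D). do_obs D a x b \<omega> = y \<and> (\<forall>v \<in> Z. obs D v \<omega> = z v)} = {}"
        "{\<omega> \<in> space (sample D). obs D b \<omega> = y \<and> obs D a \<omega> = x \<and> (\<forall>v \<in> Z. obs D v \<omega> = z v)} = {}"
        using same \<open>b \<in> Z\<close> by fastforce+
      then show ?thesis by (simp only: cond_prob_def) simp
    qed
  next
    case False
    have rb: "r b = y" using False ab by (simp add: r_def)
    define T where "T = Min (snd ` insert a Z)"
    have T: "T \<le> snd u" if "u \<in> insert a Z" for u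
      unfolding T_def using Z that by (intro Min_le) auto
    let ?W = "pinned (insert a Z) r T"
    define A where "A = (\<lambda>U. {\<omega> \<in> space (sample D). \<forall>u \<in> U. ?W u \<omega> = r u})"
    \<comment> \<open>Next, the four events of the adjustment formula are identified with events of the pinned process.\<close>
    have aa: "(a, a) \<notin> E\<^sup>+" using acyclic_E by (simp add: acyclic_def)
    have obs_Z: "(\<forall>v \<in> Z. obs D v \<omega> = z v) \<longleftrightarrow> (\<forall>u \<in> Z. ?W u \<omega> = r u)"
      if \<omega>: "\<omega> \<in> space (sample D)" for \<omega>
    proof -
      have "?W v \<omega> = obs D v \<omega>"
        if "(\<forall>u \<in> Z. obs D u \<omega> = r u) \<or> (\<forall>u \<in> Z. ?W u \<omega> = r u)" "v \<in> Z" for v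
        using pinned_obs[OF \<omega> that(1)] nd[OF that(2)] by (meson trancl_into_rtrancl)
      then show ?thesis using rZ by (metis (no_types, lifting))
    qed
    have obs_a: "obs D a \<omega> = ?W a \<omega>"
      if "\<omega> \<in> space (sample D)" "\<forall>u \<in> Z. ?W u \<omega> = r u" for \<omega>
      using pinned_obs[OF that(1) disjI2[OF that(2)] aa] by simp
    have do_b: "do_obs D a x b \<omega> = ?W b \<omega>"
      if "\<omega> \<in> space (sample D)" "\<forall>u \<in> Z. ?W u \<omega> = r u" for \<omega>
      using pinned_do_obs[OF that T, of b] ab ra by simp
    have Z_eq: "{\<omega> \<in> space (sample D). \<forall>v \<in> Z. obs D v \<omega> = z v} = A Z"
      unfolding A_def using obs_Z by blast
    have aZ_eq: "{\<omega> \<in> space (sample D). obs D a \<omega> = x \<and> (\<forall>v \<in> Z. obs D v \<omega> = z v)} = A (insert a Z)"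
      unfolding A_def using obs_Z obs_a ra by auto
    have bZ_eq: "{\<omega> \<in> space (sample D). do_obs D a x b \<omega> = y \<and> (\<forall>v \<in> Z. obs D v \<omega> = z v)} =
        A (insert b Z)"
      unfolding A_def using obs_Z do_b rb by auto
    have abZ_eq: "{\<omega> \<in> space (sample D). obs D b \<omega> = y \<and> obs D a \<omega> = x \<and> (\<forall>v \<in> Z. obs D v \<omega> = z v)} =
        A (insert b (insert a Z))"
    proof -
      have "obs D b \<omega> = y \<and> obs D a \<omega> = x \<and> (\<forall>v \<in> Z. obs D v \<omega> = z v) \<longleftrightarrow>
          (\<forall>u \<in> insert b (insert a Z). ?W u \<omega> = r u)" if \<omega>: "\<omega> \<in> space (sample D)" for \<omega>
      proof (cases "obs D a \<omega> = x \<and> (\<forall>u \<in> Z. ?W u \<omega> = r u)")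
        case True
        then have "obs D b \<omega> = ?W b \<omega>" using do_obs_consistent[OF \<omega>] do_b[OF \<omega>] by metis
        then show ?thesis using True obs_Z[OF \<omega>] obs_a[OF \<omega>] ra rb by auto
      next
        case False
        then show ?thesis using obs_Z[OF \<omega>] obs_a[OF \<omega>] ra by auto
      qed
      then show ?thesis unfolding A_def by blast
    qed
    have "prob (A (insert b (insert a Z))) * prob (A Z) =
        prob (A (insert a Z)) * prob (A (insert b Z))"
      unfolding A_def by (rule pinned_cond_indep[OF Z bd ab False r T])
    moreover have "prob (A (insert a Z)) > 0" using pos' by (simp add: aZ_eq)
    ultimately have ?eq unfolding cond_prob_def Z_eq aZ_eq bZ_eq abZ_eq by (simp add: field_simps)
    moreover have "A (insert b Z) \<in> events"
      unfolding A_def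
      using pinned_events[of "insert b Z" r "insert a Z" T r] Z r T noise_algebra_events by blast
    ultimately show ?thesis using bZ_eq by simp
  qed
  then show ?ev ?eq by blast+
qed

text \<open>
The backdoor adjustment theorem for a single model, by summation over the values of \<open>Z\<close>.
\<close>
lemma backdoor_adjusts:
  assumes "positive_dscm D" "finite Z" "backdoor_criterion E a b Z" "a \<noteq> b"
  shows "adjusts D a b Z"
  unfolding adjusts_def
proof (intro ballI)
  fix x y assume x: "x \<in> states D (fst a)" and y: "y \<in> states D (fst b)"
  let ?I = "\<Pi>\<^sub>E v \<in> Z. states D (fst v)"
  let ?A = "\<lambda>z. {\<omega> \<in> space (sample D). do_obs D a x b \<omega> = y \<and> (\<forall>v \<in> Z. obs D v \<omega> = z v)}"
  note adj = adjustment_term[OF assms x y]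
  have "disjoint_family_on ?A ?I"
    unfolding disjoint_family_on_def
  proof (intro ballI impI)
    fix z z' assume z: "z \<in> ?I" "z' \<in> ?I" "z \<noteq> z'"
    then obtain v where "v \<in> Z" "z v \<noteq> z' v" using PiE_ext[of z Z _ z'] by blast
    then show "?A z \<inter> ?A z' = {}" by auto
  qed
  then have "(\<Sum>\<^sub>\<infinity>z\<in>?I. prob (?A z)) = prob (\<Union>z\<in>?I. ?A z)"
    using adj(1) assms(2) by (intro infsum_prob_disjoint countable_PiE countable_states) auto
  also have "(\<Union>z\<in>?I. ?A z) = {\<omega> \<in> space (sample D). do_obs D a x b \<omega> = y}"
  proof (intro equalityI subsetI)
    fix \<omega> assume \<omega>: "\<omega> \<in> {\<omega> \<in> space (sample D). do_obs D a x b \<omega> = y}"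
    then have "(\<lambda>v \<in> Z. obs D v \<omega>) \<in> ?I" using measurable_space[OF random_variable_obs] by auto
    moreover have "\<omega> \<in> ?A (\<lambda>v \<in> Z. obs D v \<omega>)" using \<omega> by simp
    ultimately show "\<omega> \<in> (\<Union>z\<in>?I. ?A z)" by blast
  qed blast
  finally have "\<P>(\<omega> in sample D. do_obs D a x b \<omega> = y) = (\<Sum>\<^sub>\<infinity>z\<in>?I. prob (?A z))" ..
  also have "\<dots> = (\<Sum>\<^sub>\<infinity>z\<in>?I.
      \<P>(\<omega> in sample D. obs D b \<omega> = y \<bar> obs D a \<omega> = x \<and> (\<forall>v \<in> Z. obs D v \<omega> = z v)) *
      \<P>(\<omega> in sample D. \<forall>v \<in> Z. obs D v \<omega> = z v))"
    by (rule infsum_cong) (simp only: adj(2))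
  finally show "\<P>(\<omega> in sample D. do_obs D a x b \<omega> = y) = (\<Sum>\<^sub>\<infinity>z\<in>?I.
      \<P>(\<omega> in sample D. obs D b \<omega> = y \<bar> obs D a \<omega> = x \<and> (\<forall>v \<in> Z. obs D v \<omega> = z v)) *
      \<P>(\<omega> in sample D. \<forall>v \<in> Z. obs D v \<omega> = z v))" .
qed

end

theorem proposition1:
  fixes Ge :: "'v::finite egraph" and \<gamma>max \<gamma> :: nat and X Y :: 'v and t :: int
  assumes "is_escg \<gamma>max Ge" and "X \<noteq> Y"
  shows "(\<forall>B. finite B \<and>
              backdoor_criterion (densest_candidate \<gamma>max Ge) (X, t - int \<gamma>) (Y, t) B \<longrightarrow>
              valid_adjustment TYPE(('v, 'a, 'u, 'w) dscm) \<gamma>max Ge (X, t - int \<gamma>) (Y, t) B) \<and>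
         backdoor_criterion (densest_candidate \<gamma>max Ge) (X, t - int \<gamma>) (Y, t)
           (B_set \<gamma>max Ge X t \<gamma>)"
proof -
  let ?F = "full_lag_graph \<gamma>max Ge"
  have F: "densest_candidate \<gamma>max Ge = ?F" by (rule densest_candidate_eq[OF assms(1)])
  have acyc: "acyclic ?F"
    using full_lag_graph_candidate[OF assms(1)] by (simp add: candidates_def is_ftcg_def)
  have "adjusts D (X, t - int \<gamma>) (Y, t) B"
    if "finite B" "backdoor_criterion ?F (X, t - int \<gamma>) (Y, t) B"
      and E: "E \<in> candidates \<gamma>max Ge"
      and D: "is_dscm D" "positive_dscm D" "ftcg_of D = E" for B E and D :: "('v, 'a, 'u, 'w) dscm"
  proof -
    interpret stationary_scm D \<gamma>max
      using D E by unfold_locales (auto simp: candidates_def)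
    have "backdoor_criterion (ftcg_of D) (X, t - int \<gamma>) (Y, t) B"
      using backdoor_criterion_mono[OF _ acyc that(2)] candidate_subset_full_lag_graph[OF E] D(3)
      by blast
    then show ?thesis using backdoor_adjusts that(1) D(2) assms(2) by blast
  qed
  moreover have "backdoor_criterion ?F (X, t - int \<gamma>) (Y, t) (B_set \<gamma>max Ge X t \<gamma>)"
    using parents_backdoor_criterion[OF acyc] unfolding Par_full_lag_graph[symmetric] .
  ultimately show ?thesis unfolding F valid_adjustment_def by blast
qed

end
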